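(* There exist an exact cluster $F\subseteq\mathbb{Z}^2$ with $|F|=8$ and full affine span, and an $F$-tiling $T$, such that the orbit closure $\overline{\mathbb{Z}^2\cdot T}$ contains no $1$-periodic $F$-tiling. Consequently, writing $\bar F=\{-a: a\in F\}$, the window $\bar F$ is non-convex and has full affine span, the configuration $1_T$ satisfies $P_{1_T}(\bar F)\le|\bar F|$, and yet no configuration in the orbit closure of $1_T$ is $1$-periodic.
   Context: A cluster is a finite subset of $\mathbb{Z}^2$. An $F$-tiling is a subset $T\subseteq\mathbb{Z}^2$ such that every element of $\mathbb{Z}^2$ has a unique representation $a+t$ with $a\in F$, $t\in T$; $F$ is exact if an $F$-tiling exists. A finite set $D\subseteq\mathbb{Z}^2$ has full affine span if $D-D=\{a-b:a,b\in D\}$ generates $\mathbb{Z}^2$ as a group. A window is a finite subset of $\mathbb{Z}^2$; it is convex if it is the intersection of $\mathbb{Z}^2$ with a convex subset of $\mathbb{R}^2$. A configuration is a map $c:\mathbb{Z}^2\to\mathcal{A}$ with $\mathcal{A}$ finite. For a window $D$, $P_c(D)$ is the number of distinct $D$-patterns of $c$, i.e. of distinct functions $D\to\mathcal{A}$, $d\mapsto c(v+d)$, as $v$ ranges over $\mathbb{Z}^2$. A configuration $c$ is $1$-periodic if there is a nonzero $v\in\mathbb{Z}^2$ with $c(x+v)=c(x)$ for all $x$. $\mathbb{Z}^2$ acts on $\mathcal{A}^{\mathbb{Z}^2}$ (product topology) by $(v\cdot c)(x)=c(x-v)$, and the orbit closure of $c$ is the closure of $\{v\cdot c:v\in\mathbb{Z}^2\}$.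 A subset $T\subseteq\mathbb{Z}^2$ is identified with its indicator configuration $1_T\in\{0,1\}^{\mathbb{Z}^2}$; in particular $\overline{\mathbb{Z}^2\cdot T}$ is the orbit closure of $1_T$, and $T$ is $1$-periodic if $1_T$ is. *)

theory Defs
  imports "HOL-Analysis.Analysis" "HOL-Computational_Algebra.Group_Closure"
begin

definition tiling :: "(int \<times> int) set \<Rightarrow> (int \<times> int) set \<Rightarrow> bool" where
  "tiling F T \<longleftrightarrow> (\<forall>x. \<exists>!(a, t). a \<in> F \<and> t \<in> T \<and> x = a + t)"

definition exact :: "(int \<times> int) set \<Rightarrow> bool" where
  "exact F \<longleftrightarrow> (\<exists>T. tiling F T)"

definition full_affine_span :: "(int \<times> int) set \<Rightarrow> bool" where
  "full_affine_span D \<longleftrightarrow> group_closure {a - b | a b. a \<in> D \<and> b \<in> D} = UNIV"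

definition convex_window :: "(int \<times> int) set \<Rightarrow> bool" where
  "convex_window D \<longleftrightarrow> finite D \<and>
     (\<exists>C :: (real \<times> real) set. convex C \<and> D = {(x, y). (of_int x, of_int y) \<in> C})"

definition pattern_complexity :: "(int \<times> int \<Rightarrow> 'a) \<Rightarrow> (int \<times> int) set \<Rightarrow> nat" where
  "pattern_complexity c D = card (range (\<lambda>v. restrict (\<lambda>d. c (v + d)) D))"

definition one_periodic :: "(int \<times> int \<Rightarrow> 'a) \<Rightarrow> bool" where
  "one_periodic c \<longleftrightarrow> (\<exists>v. v \<noteq> 0 \<and> (\<forall>x. c (x + v) = c x))"

definition shift :: "int \<times> int \<Rightarrow> (int \<times> int \<Rightarrow> 'a) \<Rightarrow> int \<times> int \<Rightarrow> 'a" where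
  "shift v c = (\<lambda>x. c (x - v))"

(* The alphabet A is an explicit finite set with the discrete topology; a
   configuration over A is a function c with range c \<subseteq> A. *)
definition orbit_closure :: "'a set \<Rightarrow> (int \<times> int \<Rightarrow> 'a) \<Rightarrow> (int \<times> int \<Rightarrow> 'a) set" where
  "orbit_closure A c =
     product_topology (\<lambda>_. discrete_topology A) UNIV closure_of range (\<lambda>v. shift v c)"

abbreviation indicator_config :: "(int \<times> int) set \<Rightarrow> int \<times> int \<Rightarrow> nat" where
  "indicator_config T \<equiv> indicator T"

abbreviation tiling_orbit_closure :: "(int \<times> int) set \<Rightarrow> (int \<times> int \<Rightarrow> nat) set" where
  "tiling_orbit_closure T \<equiv> orbit_closure {0, 1} (indicator_config T)"

end

theory Submission
  imports Defs
begin

text \<open>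
  The cluster is \<open>F = {0,1,4,5} \<times> {0,1}\<close>, that is, the direct sum of the sparse square
  \<open>Q = {0,4} \<times> {0,1}\<close> and the pair \<open>{(0,0),(1,0)}\<close>. The square \<open>Q\<close> generates the lattice
  \<open>\<Lambda> = 4\<int> \<times> \<int>\<close>, whose quotient \<open>\<int>\<^sup>2/\<Lambda>\<close> is cyclic of order 4, generated by \<open>(1,0)\<close>. Hence a
  \<open>Q\<close>-tiling of the coset \<open>\<Lambda>\<close>, thickened by the pair, fills the columns congruent to 0 or 1 mod 4,
  and a \<open>Q\<close>-tiling of the coset \<open>(2,0) + \<Lambda>\<close> fills those congruent to 2 or 3; the two can be chosen
  independently, while adding the pair makes \<open>F - F\<close> generate all of \<open>\<int>\<^sup>2\<close>.

  In lattice coordinates \<open>Q\<close> is a \<open>2 \<times> 2\<close> square. Its tilings need not be rigid: the strips of width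
  2 in one of the two coordinate directions may slide freely by 0 or 1. In the first coset the
  vertical strips slide, according to a two-sided binary sequence. If \<open>(p, q)\<close> is a period of the
  tiling, so is \<open>8 (p, q)\<close>, which moves vertical strips to vertical strips and preserves row parity,
  whence \<open>p\<close> is a period of that sequence. In the second coset the horizontal strips slide, and in
  the same way \<open>4 q\<close> is a period of the sequence. The sequence used is the
  period-doubling sequence (the parity of the 2-adic valuation). It has no nonzero period, and,
  which is what makes the argument survive limits, every \<open>p \<noteq> 0\<close> is refuted as a period inside each
  interval of a length depending only on \<open>p\<close> (\<open>period_doubling_mismatch\<close>). Therefore every nonzero
  vector is refuted as a period of the tiling inside each square of bounded size
  (\<open>sliding_tiling_mismatch\<close>). As configurations in the orbit closure show only patterns that occur
  in the tiling, none of them is 1-periodic.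

  The inequality between complexity and cardinality holds for all tilings: the translate
  \<open>v - F\<close> meets \<open>T\<close> in exactly one point, so a pattern of \<open>1\<^sub>T\<close> seen through \<open>-F\<close> is determined by an
  element of \<open>F\<close>.
\<close>

section \<open>Tilings, spans and orbit closures in general\<close>

lemma tiling_iff:
  "tiling F T \<longleftrightarrow> (\<forall>x. \<exists>!a. a \<in> F \<and> x - a \<in> T)"
proof -
  have "(\<exists>!(a, t). a \<in> F \<and> t \<in> T \<and> x = a + t) \<longleftrightarrow> (\<exists>!a. a \<in> F \<and> x - a \<in> T)" for x :: "int \<times> int"
  proof
    assume "\<exists>!(a, t). a \<in> F \<and> t \<in> T \<and> x = a + t"
    then obtain a t where at: "a \<in> F" "t \<in> T" "x = a + t"
      and uniq: "\<And>b s. b \<in> F \<Longrightarrow> s \<in> T \<Longrightarrow> x = b + s \<Longrightarrow> (b, s) = (a, t)"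
      by (auto simp: Ex1_def)
    show "\<exists>!a. a \<in> F \<and> x - a \<in> T"
    proof (rule ex1I[of _ a])
      show "a \<in> F \<and> x - a \<in> T" using at by simp
      show "b = a" if "b \<in> F \<and> x - b \<in> T" for b
        using uniq[of b "x - b"] that by simp
    qed
  next
    assume "\<exists>!a. a \<in> F \<and> x - a \<in> T"
    then obtain a where a: "a \<in> F" "x - a \<in> T"
      and uniq: "\<And>b. b \<in> F \<Longrightarrow> x - b \<in> T \<Longrightarrow> b = a"
      by blast
    show "\<exists>!(a, t). a \<in> F \<and> t \<in> T \<and> x = a + t"
    proof (rule ex1I[of _ "(a, x - a)"])
      show "case (a, x - a) of (a, t) \<Rightarrow> a \<in> F \<and> t \<in> T \<and> x = a + t" using a by simp
      show "z = (a, x - a)" if "case z of (b, t) \<Rightarrow> b \<in> F \<and> t \<in> T \<and> x = b + t" for z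
      proof -
        obtain b t where "z = (b, t)" by (metis surj_pair)
        moreover from this have "b \<in> F" "t \<in> T" "x = b + t" using that by auto
        moreover from this have "b = a" using uniq[of b] by simp
        ultimately show ?thesis by simp
      qed
    qed
  qed
  then show ?thesis by (simp only: tiling_def)
qed

text \<open>The unique \<open>a \<in> F\<close> with \<open>v - a \<in> T\<close> determines the pattern at \<open>v\<close>: it is the indicator of
  \<open>-a\<close>.\<close>

lemma tiling_pattern_complexity_le:
  assumes "tiling F T" "finite F"
  shows "pattern_complexity (indicator_config T) (uminus ` F) \<le> card (uminus ` F)"
proof -
  define G where "G = (\<lambda>a. restrict (\<lambda>d. of_bool (d = - a) :: nat) (uminus ` F))"
  have "restrict (\<lambda>d. indicator_config T (v + d)) (uminus ` F) \<in> G ` F" for v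
  proof -
    obtain a where a: "a \<in> F" "v - a \<in> T"
      and uniq: "\<And>b. b \<in> F \<Longrightarrow> v - b \<in> T \<Longrightarrow> b = a"
      using assms(1) unfolding tiling_iff by blast
    have "indicator_config T (v + - b) = of_bool (- b = - a)" if "b \<in> F" for b
      using a(2) uniq[OF that] by (cases "b = a") (auto simp: indicator_def)
    then have "indicator_config T (v + d) = of_bool (d = - a)" if "d \<in> uminus ` F" for d
      using that by blast
    then have "restrict (\<lambda>d. indicator_config T (v + d)) (uminus ` F) = G a"
      unfolding G_def by (intro restrict_ext)
    then show ?thesis using a(1) by blast
  qed
  then have "range (\<lambda>v. restrict (\<lambda>d. indicator_config T (v + d)) (uminus ` F)) \<subseteq> G ` F"
    by blast
  then have "pattern_complexity (indicator_config T) (uminus ` F) \<le> card (G ` F)"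
    unfolding pattern_complexity_def using assms(2) by (intro card_mono) auto
  also have "\<dots> \<le> card F" by (rule card_image_le[OF assms(2)])
  also have "\<dots> = card (uminus ` F)" by (simp add: card_image)
  finally show ?thesis .
qed

lemma group_closure_eq_UNIV_if_unit_vectors:
  fixes S :: "(int \<times> int) set"
  assumes "(1, 0) \<in> S" "(0, 1) \<in> S"
  shows "group_closure S = UNIV"
proof -
  have multiples: "(m * a, m * b) \<in> group_closure S" if "(a, b) \<in> S" for a b m :: int
  proof (induction m rule: int_induct[of _ 0])
    case base
    show ?case using zero_in_group_closure[of S] by (simp add: zero_prod_def)
  next
    case (step1 m)
    from group_closure_add[OF step1(2) group_closure.base[of "(a, b)"]] that
    show ?case by (simp add: algebra_simps)
  next
    case (step2 m)
    from group_closure.diff[OF step2(2) group_closure.base[of "(a, b)"]] that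
    show ?case by (simp add: algebra_simps)
  qed
  have "(m, n) \<in> group_closure S" for m n
    using group_closure_add[OF multiples[OF assms(1), of m] multiples[OF assms(2), of n]] by simp
  then show ?thesis by auto
qed

lemma full_affine_span_if_unit_steps:
  assumes "a \<in> D" "a + (1, 0) \<in> D" "b \<in> D" "b + (0, 1) \<in> D"
  shows "full_affine_span D"
  unfolding full_affine_span_def
proof (rule group_closure_eq_UNIV_if_unit_vectors; rule CollectI)
  show "\<exists>x y. (1, 0) = x - y \<and> x \<in> D \<and> y \<in> D"
    using assms(1,2) by (intro exI[of _ "a + (1, 0)"] exI[of _ a]) simp
  show "\<exists>x y. (0, 1) = x - y \<and> x \<in> D \<and> y \<in> D"
    using assms(3,4) by (intro exI[of _ "b + (0, 1)"] exI[of _ b]) simp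
qed

lemma orbit_closure_agrees_on_finite:
  assumes "c \<in> orbit_closure A d" "finite W"
  obtains u where "\<And>x. x \<in> W \<Longrightarrow> c x = d (x - u)"
proof -
  let ?X = "product_topology (\<lambda>_. discrete_topology A) (UNIV :: (int \<times> int) set)"
  let ?U = "PiE UNIV (\<lambda>x. if x \<in> W then {c x} else A)"
  have c: "c \<in> PiE UNIV (\<lambda>_. A)"
    using assms(1) unfolding orbit_closure_def by (simp add: in_closure_of)
  have "openin ?X ?U"
    using c assms(2)
    by (intro product_topology_basis) (auto intro: finite_subset[OF _ assms(2)])
  moreover have "c \<in> ?U" using c by auto
  ultimately obtain u where "shift u d \<in> ?U"
    using assms(1) unfolding orbit_closure_def in_closure_of by blast
  then have "d (x - u) \<in> (if x \<in> W then {c x} else A)" for x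
    unfolding shift_def PiE_iff by blast
  then have "c x = d (x - u)" if "x \<in> W" for x
    using that by (metis singletonD)
  then show thesis by (rule that)
qed

section \<open>The period-doubling sequence\<close>

definition period_doubling :: "int \<Rightarrow> int" where
  "period_doubling i = int (multiplicity 2 i mod 2)"

lemma period_doubling_cases: "period_doubling i = 0 \<or> period_doubling i = 1"
  unfolding period_doubling_def by linarith

text \<open>Write \<open>p = 2\<^sup>k m\<close> with \<open>m\<close> odd. If \<open>i = 2\<^sup>k u\<close> with \<open>u + m \<equiv> 2\<close> modulo 4, then \<open>u\<close> is odd, so
  the valuations of \<open>i\<close> and \<open>i + p\<close> are \<open>k\<close> and \<open>k + 1\<close>, of different parity. Such \<open>i\<close> form a residue
  class modulo \<open>2\<^sup>k\<^sup>+\<^sup>2\<close>.\<close>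

lemma period_doubling_mismatch:
  assumes "p \<noteq> 0"
  obtains L where "L > 0" "\<And>n. \<exists>i\<in>{n..<n + L}. period_doubling i \<noteq> period_doubling (i + p)"
proof -
  define k where "k = multiplicity 2 p"
  obtain m where m: "p = 2 ^ k * m" "odd m"
    using multiplicity_decompose'[of p 2] assms unfolding k_def by auto
  define L :: int where "L = 2 ^ k * 4"
  show thesis
  proof (rule that)
    show "L > 0" by (simp add: L_def)
    show "\<exists>i\<in>{n..<n + L}. period_doubling i \<noteq> period_doubling (i + p)" for n
    proof -
      \<comment> \<open>the representative in \<open>{n..<n + L}\<close> of the class of \<open>2\<^sup>k (2 - m)\<close> modulo \<open>L\<close>\<close>
      define r where "r = 2 ^ k * (2 - m)"
      define i where "i = n + (r - n) mod L"
      have "i = r - L * ((r - n) div L)"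
        unfolding i_def by (simp add: minus_div_mult_eq_mod[symmetric] mult.commute)
      then obtain s where s: "i = r + L * s"
        by (metis minus_mult_right uminus_add_conv_diff add.commute)
      have i: "i = 2 ^ k * (2 - m + 4 * s)"
        unfolding s r_def L_def by (simp add: algebra_simps)
      have ip: "i + p = 2 ^ Suc k * (1 + 2 * s)"
        unfolding i m(1) by (simp add: algebra_simps)
      have "multiplicity 2 i = k"
        unfolding i using m(2) by (intro multiplicity_eqI) auto
      moreover have "multiplicity 2 (i + p) = Suc k"
      proof (rule multiplicity_eqI)
        show "2 ^ Suc k dvd i + p" unfolding ip by simp
        have "2 ^ Suc (Suc k) dvd i + p \<longleftrightarrow> 2 ^ Suc k * 2 dvd 2 ^ Suc k * (1 + 2 * s)"
          unfolding ip by (simp add: mult.commute)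
        also have "\<dots> \<longleftrightarrow> 2 dvd 1 + 2 * s" by (rule dvd_mult_cancel_left[THEN trans]) simp
        finally show "\<not> 2 ^ Suc (Suc k) dvd i + p" by simp
      qed
      ultimately have "period_doubling i \<noteq> period_doubling (i + p)"
        unfolding period_doubling_def by simp presburger
      moreover have "i \<in> {n..<n + L}"
        unfolding i_def using \<open>L > 0\<close> by simp
      ultimately show ?thesis by blast
    qed
  qed
qed

section \<open>The cluster and its sliding tiling\<close>

definition cluster :: "(int \<times> int) set" where
  "cluster = {0, 1, 4, 5} \<times> {0, 1}"

text \<open>The first set, called the translation vectors of the first kind below, lies in \<open>\<Lambda>\<close> and slides
  the vertical strip \<open>{8 * i..<8 * i + 8} \<times> UNIV\<close> by \<open>period_doubling i\<close>. The second, those of the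
  second kind, lies in \<open>(2, 0) + \<Lambda>\<close> and slides the horizontal strip \<open>UNIV \<times> {2 * j, 2 * j + 1}\<close> by
  \<open>period_doubling j\<close> steps of length 4.\<close>

definition sliding_tiling :: "(int \<times> int) set" where
  "sliding_tiling =
     {(8 * i, 2 * j + period_doubling i) | i j. True} \<union>
     {(8 * i + 4 * period_doubling j + 2, 2 * j) | i j. True}"

lemma full_affine_span_cluster: "full_affine_span cluster"
  by (rule full_affine_span_if_unit_steps[of "(0, 0)" _ "(0, 0)"]) (simp_all add: cluster_def)

lemma full_affine_span_uminus_cluster: "full_affine_span (uminus ` cluster)"
  by (rule full_affine_span_if_unit_steps[of "(-1, 0)" _ "(0, -1)"])
    (simp_all add: cluster_def image_iff)

text \<open>The point \<open>(-2, 0)\<close> is missing, although it is the midpoint of \<open>(0, 0)\<close> and \<open>(-4, 0)\<close>.\<close>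

lemma not_convex_window_uminus_cluster: "\<not> convex_window (uminus ` cluster)"
proof
  assume "convex_window (uminus ` cluster)"
  then obtain C :: "(real \<times> real) set"
    where C: "convex C" "uminus ` cluster = {(x, y). (of_int x, of_int y) \<in> C}"
    unfolding convex_window_def by blast
  have "- (0, 0) \<in> uminus ` cluster" "- (4, 0) \<in> uminus ` cluster"
    by (intro imageI; simp add: cluster_def)+
  then have "(0, 0) \<in> C" "(-4, 0) \<in> C" unfolding C(2) by auto
  then have "(1/2) *\<^sub>R (0, 0) + (1/2) *\<^sub>R (-4, 0) \<in> C"
    by (intro convexD[OF C(1)]) auto
  then have "(-2, 0) \<in> uminus ` cluster" unfolding C(2) by simp
  then show False by (auto simp: cluster_def)
qed

lemma mem_sliding_tiling_iff:
  "(x, y) \<in> sliding_tiling \<longleftrightarrow>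
     x mod 8 = 0 \<and> (y - period_doubling (x div 8)) mod 2 = 0 \<or>
     y mod 2 = 0 \<and> (x - 2 - 4 * period_doubling (y div 2)) mod 8 = 0"
  (is "_ \<longleftrightarrow> ?P \<or> ?Q")
proof -
  have "(\<exists>i j. x = 8 * i \<and> y = 2 * j + period_doubling i) \<longleftrightarrow> ?P"
  proof
    assume ?P
    then have "x = 8 * (x div 8)"
      "y = 2 * ((y - period_doubling (x div 8)) div 2) + period_doubling (x div 8)" by auto
    then show "\<exists>i j. x = 8 * i \<and> y = 2 * j + period_doubling i" by blast
  qed auto
  moreover have "(\<exists>i j. x = 8 * i + 4 * period_doubling j + 2 \<and> y = 2 * j) \<longleftrightarrow> ?Q"
  proof
    assume ?Q
    then have "x = 8 * ((x - 2 - 4 * period_doubling (y div 2)) div 8)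
        + 4 * period_doubling (y div 2) + 2" "y = 2 * (y div 2)" by auto
    then show "\<exists>i j. x = 8 * i + 4 * period_doubling j + 2 \<and> y = 2 * j" by blast
  qed auto
  moreover have "(x, y) \<in> sliding_tiling \<longleftrightarrow>
      (\<exists>i j. x = 8 * i \<and> y = 2 * j + period_doubling i) \<or>
      (\<exists>i j. x = 8 * i + 4 * period_doubling j + 2 \<and> y = 2 * j)"
    unfolding sliding_tiling_def by auto
  ultimately show ?thesis by (simp only:)
qed

lemma diff_mod_eq_0_iff:
  fixes a m x :: int
  assumes "0 \<le> a" "a < m"
  shows "(x - a) mod m = 0 \<longleftrightarrow> a = x mod m"
  using assms by (metis dvd_eq_mod_eq_0 mod_eq_dvd_iff mod_pos_pos_trivial)

text \<open>Tiles of the first kind cover exactly the columns congruent to 0 or 1 mod 4, tiles of the second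
  kind the others. For a point in a column of the former sort, its position in the covering tile
  is the column modulo 8 together with the row parity relative to the phase of its vertical strip;
  for the other points it is the row parity together with the column modulo 8 relative to the phase
  of the horizontal strip.\<close>

lemma tiling_cluster_sliding_tiling: "tiling cluster sliding_tiling"
  unfolding tiling_iff
proof (rule allI)
  fix z :: "int \<times> int"
  obtain x y where z: "z = (x, y)" by fastforce
  define f where "f = period_doubling (x div 8)"
  define g where "g = period_doubling (y div 2)"
  have f: "f = 0 \<or> f = 1" and g: "g = 0 \<or> g = 1"
    unfolding f_def g_def by (rule period_doubling_cases)+
  define A :: "int set" where "A = {0, 1, 4, 5}"
  have first: "(x - a) mod 8 = 0 \<longleftrightarrow> a = x mod 8"
    "(x - a - 2 - 4 * g) mod 8 = 0 \<longleftrightarrow> a = (x - 2 - 4 * g) mod 8" if "a \<in> A" for a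
  proof -
    have a: "0 \<le> a" "a < 8" using that by (auto simp: A_def)
    show "(x - a) mod 8 = 0 \<longleftrightarrow> a = x mod 8" by (rule diff_mod_eq_0_iff[OF a])
    have "x - a - 2 - 4 * g = x - 2 - 4 * g - a" by simp
    then show "(x - a - 2 - 4 * g) mod 8 = 0 \<longleftrightarrow> a = (x - 2 - 4 * g) mod 8"
      by (simp only: diff_mod_eq_0_iff[OF a])
  qed
  have second: "(y - b) mod 2 = 0 \<longleftrightarrow> b = y mod 2"
    "(y - b - f) mod 2 = 0 \<longleftrightarrow> b = (y - f) mod 2" if "b \<in> {0, 1}" for b
  proof -
    have b: "0 \<le> b" "b < 2" using that by auto
    show "(y - b) mod 2 = 0 \<longleftrightarrow> b = y mod 2" by (rule diff_mod_eq_0_iff[OF b])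
    have "y - b - f = y - f - b" by simp
    then show "(y - b - f) mod 2 = 0 \<longleftrightarrow> b = (y - f) mod 2"
      by (simp only: diff_mod_eq_0_iff[OF b])
  qed
  \<comment> \<open>A translation vector of the first kind lies in the same vertical strip as the point it covers, and
    one of the second kind in the same horizontal strip; so only the phases \<open>f\<close> and \<open>g\<close> enter.\<close>
  have strip: "(x - x mod 8) div 8 = x div 8" "(y - y mod 2) div 2 = y div 2"
    by (simp_all add: minus_mod_eq_mult_div)
  have mem: "(a, b) \<in> cluster \<and> z - (a, b) \<in> sliding_tiling \<longleftrightarrow>
      a = x mod 8 \<and> a \<in> A \<and> b = (y - f) mod 2 \<or>
      a = (x - 2 - 4 * g) mod 8 \<and> a \<in> A \<and> b = y mod 2" for a b
  proof (cases "a \<in> A \<and> b \<in> {0, 1}")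
    case True
    then have ab: "a \<in> A" "b \<in> {0, 1}" by blast+
    have "(x - a) mod 8 = 0 \<and> (y - b - period_doubling ((x - a) div 8)) mod 2 = 0 \<longleftrightarrow>
        a = x mod 8 \<and> b = (y - f) mod 2"
      using first(1)[OF ab(1)] second(2)[OF ab(2)] strip(1) unfolding f_def by metis
    moreover have "(y - b) mod 2 = 0 \<and> (x - a - 2 - 4 * period_doubling ((y - b) div 2)) mod 8 = 0
        \<longleftrightarrow> a = (x - 2 - 4 * g) mod 8 \<and> b = y mod 2"
      using first(2)[OF ab(1)] second(1)[OF ab(2)] strip(2) unfolding g_def by metis
    moreover have "(a, b) \<in> cluster" using ab unfolding cluster_def A_def by blast
    ultimately show ?thesis
      using ab(1) by (simp only: z diff_Pair mem_sliding_tiling_iff simp_thms)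
  next
    case False
    then have "(a, b) \<notin> cluster" unfolding cluster_def A_def by blast
    moreover have "n mod 2 \<in> {0, 1}" for n :: int by auto
    ultimately show ?thesis using False by metis
  qed
  \<comment> \<open>\<open>A\<close> consists of residues modulo 8, is invariant under adding 4, and is exchanged with its
    complement by adding 2.\<close>
  have exclusive: "x mod 8 \<in> A \<longleftrightarrow> (x - 2 - 4 * g) mod 8 \<notin> A"
  proof -
    have "x mod 8 \<in> {0, 1, 2, 3, 4, 5, 6, 7}"
      using pos_mod_bound[of 8 x] pos_mod_sign[of 8 x] by auto
    moreover have "(x - 2 - 4 * g) mod 8 = (x mod 8 - 2 - 4 * g) mod 8"
      by (simp add: mod_simps diff_diff_eq)
    ultimately show ?thesis using g unfolding A_def by (elim insertE disjE emptyE) simp_all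
  qed
  show "\<exists>!w. w \<in> cluster \<and> z - w \<in> sliding_tiling"
  proof (cases "x mod 8 \<in> A")
    case True
    then show ?thesis using exclusive
      by (intro ex1I[of _ "(x mod 8, (y - f) mod 2)"]) (auto simp only: mem split_paired_all)
  next
    case False
    then show ?thesis using exclusive
      by (intro ex1I[of _ "((x - 2 - 4 * g) mod 8, y mod 2)"])
        (auto simp only: mem split_paired_all)
  qed
qed

section \<open>Every period is refuted locally\<close>

text \<open>The horizontal component of the vector is refuted by the tiles of the first kind, whose heights
  depend on the column, and the vertical one by the tiles of the second kind, whose columns depend
  on the row. A multiple of 8 maps translation vectors of each kind into the coset of \<open>\<Lambda>\<close> that
  contains this kind, so that the two kinds never have to be compared.\<close>

lemma sliding_tiling_mismatch:
  assumes "(p, q) \<noteq> (0, 0)"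
  obtains N :: int where "\<And>u v. \<exists>x\<in>{u..u + N}. \<exists>y\<in>{v..v + N}.
    (x, y) \<in> sliding_tiling \<and> (x + 8 * p, y + 8 * q) \<notin> sliding_tiling"
proof (cases "p = 0")
  case False
  then obtain L where L: "L > 0"
    "\<And>n. \<exists>i\<in>{n..<n + L}. period_doubling i \<noteq> period_doubling (i + p)"
    using period_doubling_mismatch by blast
  show thesis
  proof (rule that[of "8 * L + 8"])
    fix u v :: int
    obtain i where i: "i \<in> {u div 8 + 1..<u div 8 + 1 + L}"
      "period_doubling i \<noteq> period_doubling (i + p)" using L(2) by blast
    define y where "y = v + (period_doubling i - v) mod 2"
    have "8 * i \<in> {u..u + (8 * L + 8)}" using i(1) by auto
    moreover have "y \<in> {v..v + (8 * L + 8)}"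
      using L(1) pos_mod_bound[of 2 "period_doubling i - v"] by (auto simp: y_def)
    moreover have y: "(y - period_doubling i) mod 2 = 0" unfolding y_def by presburger
    then have "(8 * i, y) \<in> sliding_tiling" by (simp add: mem_sliding_tiling_iff)
    moreover have "(y + 8 * q - period_doubling (i + p)) mod 2 \<noteq> 0"
      using y i(2) period_doubling_cases[of i] period_doubling_cases[of "i + p"] by presburger
    then have "(8 * i + 8 * p, y + 8 * q) \<notin> sliding_tiling"
      using period_doubling_cases[of "(y + 8 * q) div 2"]
      unfolding mem_sliding_tiling_iff distrib_left[symmetric] by simp presburger
    ultimately show "\<exists>x\<in>{u..u + (8 * L + 8)}. \<exists>y\<in>{v..v + (8 * L + 8)}.
      (x, y) \<in> sliding_tiling \<and> (x + 8 * p, y + 8 * q) \<notin> sliding_tiling" by blast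
  qed
next
  case True
  then have "4 * q \<noteq> 0" using assms by simp
  then obtain L where L: "L > 0"
    "\<And>n. \<exists>j\<in>{n..<n + L}. period_doubling j \<noteq> period_doubling (j + 4 * q)"
    using period_doubling_mismatch by blast
  show thesis
  proof (rule that[of "2 * L + 8"])
    fix u v :: int
    obtain j where j: "j \<in> {v div 2 + 1..<v div 2 + 1 + L}"
      "period_doubling j \<noteq> period_doubling (j + 4 * q)" using L(2) by blast
    define x where "x = u + (2 + 4 * period_doubling j - u) mod 8"
    have "2 * j \<in> {v..v + (2 * L + 8)}" using j(1) by auto
    moreover have "x \<in> {u..u + (2 * L + 8)}"
      using L(1) pos_mod_bound[of 8 "2 + 4 * period_doubling j - u"] by (auto simp: x_def)
    moreover have x: "(x - 2 - 4 * period_doubling j) mod 8 = 0" unfolding x_def by presburger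
    then have "(x, 2 * j) \<in> sliding_tiling" by (simp add: mem_sliding_tiling_iff)
    moreover have "(x - 2 - 4 * period_doubling (j + 4 * q)) mod 8 \<noteq> 0"
      using x j(2) period_doubling_cases[of j] period_doubling_cases[of "j + 4 * q"]
      by presburger
    moreover have "x mod 8 \<noteq> 0" using x period_doubling_cases[of j] by presburger
    ultimately show "\<exists>x\<in>{u..u + (2 * L + 8)}. \<exists>y\<in>{v..v + (2 * L + 8)}.
      (x, y) \<in> sliding_tiling \<and> (x + 8 * p, y + 8 * q) \<notin> sliding_tiling"
      using True by (intro bexI[of _ x] bexI[of _ "2 * j"]) (auto simp: mem_sliding_tiling_iff)
  qed
qed

text \<open>A period \<open>(p, q)\<close> of \<open>c\<close> yields the period \<open>8 (p, q)\<close>. Choose a square in which this vector is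
  refuted as a period of every translate of the tiling; on the square and its shift by the vector,
  \<open>c\<close> coincides with one of these translates.\<close>

lemma sliding_tiling_orbit_closure_not_periodic:
  assumes "c \<in> tiling_orbit_closure sliding_tiling"
  shows "\<not> one_periodic c"
proof
  assume "one_periodic c"
  then obtain p q where pq: "(p, q) \<noteq> (0, 0)" "\<And>x. c (x + (p, q)) = c x"
    unfolding one_periodic_def zero_prod_def by (metis surj_pair)
  have multiple: "c (x + (int n * p, int n * q)) = c x" for n x
  proof (induction n)
    case 0
    show ?case by (simp flip: zero_prod_def)
  next
    case (Suc n)
    have "x + (int (Suc n) * p, int (Suc n) * q) = (x + (int n * p, int n * q)) + (p, q)"
      by (cases x) (simp add: algebra_simps)
    then show ?case using pq(2) Suc by metis
  qed
  obtain N where N: "\<And>u v. \<exists>x\<in>{u..u + N}. \<exists>y\<in>{v..v + N}.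
    (x, y) \<in> sliding_tiling \<and> (x + 8 * p, y + 8 * q) \<notin> sliding_tiling"
    using sliding_tiling_mismatch[OF pq(1)] by metis
  define W where "W = {0..N} \<times> {0..N}"
  have "finite (W \<union> (\<lambda>x. x + (8 * p, 8 * q)) ` W)" unfolding W_def by simp
  then obtain s where s: "\<And>x. x \<in> W \<union> (\<lambda>x. x + (8 * p, 8 * q)) ` W \<Longrightarrow>
      c x = indicator_config sliding_tiling (x - s)"
    using orbit_closure_agrees_on_finite[OF assms] by metis
  obtain u v where uv: "s = (u, v)" by fastforce
  obtain x y where xy: "x \<in> {-u..-u + N}" "y \<in> {-v..-v + N}"
    "(x, y) \<in> sliding_tiling" "(x + 8 * p, y + 8 * q) \<notin> sliding_tiling"
    using N by blast
  have "(x + u, y + v) \<in> W" using xy(1,2) by (auto simp: W_def)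
  then have "c (x + u, y + v) = indicator_config sliding_tiling ((x + u, y + v) - s)"
    "c ((x + u, y + v) + (8 * p, 8 * q)) =
       indicator_config sliding_tiling ((x + u, y + v) + (8 * p, 8 * q) - s)"
    using s by blast+
  then have "c (x + u, y + v) \<noteq> c ((x + u, y + v) + (8 * p, 8 * q))"
    using xy(3,4) by (simp add: uv algebra_simps)
  then show False using multiple[of "(x + u, y + v)" 8] by simp
qed

theorem theorem1p1:
  shows "\<exists>F T :: (int \<times> int) set.
    finite F \<and> exact F \<and> card F = 8 \<and> full_affine_span F \<and> tiling F T \<and>
    \<not> (\<exists>T'. tiling F T' \<and> indicator_config T' \<in> tiling_orbit_closure T \<and>
          one_periodic (indicator_config T')) \<and>
    \<not> convex_window (uminus ` F) \<and> full_affine_span (uminus ` F) \<and>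
    pattern_complexity (indicator_config T) (uminus ` F) \<le> card (uminus ` F) \<and>
    \<not> (\<exists>c \<in> tiling_orbit_closure T. one_periodic c)"
proof -
  have "finite cluster" "card cluster = 8"
    by (simp_all add: cluster_def)
  moreover have "exact cluster"
    unfolding exact_def using tiling_cluster_sliding_tiling by blast
  ultimately show ?thesis
    using tiling_cluster_sliding_tiling full_affine_span_cluster full_affine_span_uminus_cluster
      not_convex_window_uminus_cluster sliding_tiling_orbit_closure_not_periodic
      tiling_pattern_complexity_le[OF tiling_cluster_sliding_tiling]
    by (intro exI[of _ cluster] exI[of _ sliding_tiling]) blast
qed

end
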